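(* The generating function for $S\left(2\mathbb{N},n\right)$ is given by $$\sum_{n=1}^\infty S\left(2\mathbb{N},n\right)q^n= \frac{\left(-q^2;q^2\right)_\infty}{\left(q;q^2\right)_\infty} \sum_{n=1}^\infty \frac{q^n}{\left(1-(-q)^n\right)^2}.$$
   Context: The identity is one of formal power series in $q$. The $q$-Pochhammer symbol is $(a;q)_\infty:=\prod_{m=0}^{\infty}(1-aq^m)$, so that $(-q^2;q^2)_\infty=\prod_{m\ge 1}(1+q^{2m})$ and $(q;q^2)_\infty=\prod_{m\ge 0}(1-q^{2m+1})$. $\mathbb{N}=\{1,2,3,\dots\}$ and $2\mathbb{N}=\{2,4,6,\dots\}$. A partition of $n\in\mathbb{N}$ is a non-increasing sequence $(\lambda_1,\dots,\lambda_s)$ of natural numbers (its parts) with $\sum_{j=1}^s\lambda_j=n$. For a subset $D\subset\mathbb{N}$, $S(D,n)\in\mathbb{Z}$ denotes the sum of all odd parts minus the sum of all even parts, taken over all partitions of $n$ in which parts from $D$ do not repeat (each element of $D$ occurs at most once as a part, while parts not in $D$ may repeat arbitrarily); parts are counted with multiplicity. Thus $S(2\mathbb{N},n)$ concerns partitions of $n$ whose even parts are distinct and whose odd parts are unrestricted. *)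

theory Defs
  imports
    "HOL-Analysis.Infinite_Products"
    "HOL-Computational_Algebra.Formal_Power_Series"
begin

unbundle fps_syntax

section \<open>Partitions and the sum of odd parts minus even parts\<close>

definition partitions :: "nat \<Rightarrow> nat list set" where
  "partitions n = {xs. sorted_wrt (\<ge>) xs \<and> (\<forall>x\<in>set xs. 0 < x) \<and> sum_list xs = n}"

definition partitions_distinct_on :: "nat set \<Rightarrow> nat \<Rightarrow> nat list set" where
  "partitions_distinct_on D n = {xs \<in> partitions n. \<forall>d\<in>D. count_list xs d \<le> 1}"

definition S :: "nat set \<Rightarrow> nat \<Rightarrow> int" where
  "S D n = (\<Sum>xs\<in>partitions_distinct_on D n.
     int (sum_list (filter odd xs)) - int (sum_list (filter even xs)))"

text \<open>The sum in \<^term>\<open>S D n\<close> ranges over a finite set, so it is not a default value.\<close>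

lemma finite_partitions: "finite (partitions n)"
proof (rule finite_subset)
  show "partitions n \<subseteq> {xs. set xs \<subseteq> {..n} \<and> length xs \<le> n}"
  proof safe
    fix xs x assume xs: "xs \<in> partitions n"
    show "x \<le> n" if "x \<in> set xs"
      using xs that member_le_sum_list[of x xs] by (simp add: partitions_def)
    have "length xs \<le> sum_list xs" if "\<forall>x\<in>set xs. 0 < x"
      using that by (induction xs) auto
    with xs show "length xs \<le> n"
      by (simp add: partitions_def)
  qed
qed (simp add: finite_lists_length_le)

lemma finite_partitions_distinct_on: "finite (partitions_distinct_on D n)"
  unfolding partitions_distinct_on_def by (rule finite_subset[OF _ finite_partitions]) auto

section \<open>Infinite q-Pochhammer symbols of formal power series\<close>

text \<open>
  Limits (in \<^const>\<open>prodinf\<close> and \<^const>\<open>suminf\<close>) are taken in the library topology on formal power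
  series, in which convergence means that every coefficient is eventually constant.
\<close>

definition qpochhammer_inf :: "'a::comm_ring_1 fps \<Rightarrow> 'a fps \<Rightarrow> 'a fps" where
  "qpochhammer_inf a q = (\<Prod>m. 1 - a * q ^ m)"

text \<open>
  The following two facts guarantee that the infinite products and series considered here converge,
  so that \<^const>\<open>prodinf\<close> and \<^const>\<open>suminf\<close> denote genuine limits.
\<close>

lemma nth_mult_power_eq_0:
  fixes h q :: "'a::comm_ring_1 fps"
  assumes "q $ 0 = 0" "j < m"
  shows "(h * q ^ m) $ j = 0"
  using assms by (auto simp: fps_mult_nth startsby_zero_power_prefix intro!: sum.neutral)

lemma has_prod_qpochhammer_inf:
  fixes a q :: "'a::idom fps"
  assumes "a $ 0 = 0" "q $ 0 = 0"
  shows "(\<lambda>m. 1 - a * q ^ m) has_prod qpochhammer_inf a q"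
proof -
  define P where "P n = (\<Prod>m\<le>n. 1 - a * q ^ m)" for n
  define L where "L = Abs_fps (\<lambda>j. P j $ j)"
  have stable: "P n $ j = P j $ j" if "j \<le> n" for n j
    using that
  proof (induction n rule: dec_induct)
    case (step n)
    have "P (Suc n) = P n - (P n * a) * q ^ Suc n"
      by (simp add: P_def algebra_simps)
    moreover have "((P n * a) * q ^ Suc n) $ j = 0"
      using step by (intro nth_mult_power_eq_0 assms) auto
    ultimately show ?case
      using step by simp
  qed simp
  have "P \<longlonglongrightarrow> L"
    by (rule tendsto_fpsI) (auto simp: L_def intro: eventually_sequentiallyI stable)
  moreover have "L $ 0 = 1"
    using assms by (simp add: L_def P_def)
  hence "L \<noteq> 0"
    by auto
  ultimately have "(\<lambda>m. 1 - a * q ^ m) has_prod L"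
    by (simp add: has_prod_def raw_has_prod_def P_def [abs_def])
  thus ?thesis
    using has_prod_unique qpochhammer_inf_def by metis
qed

lemma summable_fps_X_power_mult:
  fixes f :: "nat \<Rightarrow> 'a::comm_ring_1 fps"
  shows "summable (\<lambda>n. fps_X ^ Suc n * f n)"
proof -
  let ?g = "\<lambda>n. fps_X ^ Suc n * f n"
  have "(\<lambda>n. \<Sum>k<n. ?g k) \<longlonglongrightarrow> Abs_fps (\<lambda>j. (\<Sum>k<j. ?g k) $ j)"
  proof (rule tendsto_fpsI, rule eventually_sequentiallyI)
    fix j n :: nat assume "j \<le> n"
    have "?g k $ j = 0" if "j \<le> k" for k
      using that nth_mult_power_eq_0[of fps_X j "Suc k" "f k"] by (simp add: mult.commute)
    hence "(\<Sum>k<j. ?g k $ j) = (\<Sum>k<n. ?g k $ j)"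
      using \<open>j \<le> n\<close> by (intro sum.mono_neutral_left) auto
    thus "(\<Sum>k<n. ?g k) $ j = Abs_fps (\<lambda>j. (\<Sum>k<j. ?g k) $ j) $ j"
      by (simp add: fps_sum_nth)
  qed
  thus ?thesis
    by (auto simp: summable_def sums_def)
qed

end

theory Submission
  imports Defs
begin

text \<open>
  Fix \<open>D\<close> and give every part \<open>k\<close> a weight \<open>w k\<close>. By a choice of multiplicity for each part, the
  partitions whose parts from \<open>D\<close> do not repeat are counted by the product over \<open>k\<close> of
  \<open>1 + X\<^sup>k\<close> (for \<open>k \<in> D\<close>) or \<open>1 / (1 - X\<^sup>k)\<close> (for \<open>k \<notin> D\<close>). Replacing \<open>X\<^sup>k\<close> by \<open>z X\<^sup>k\<close> in a single
  factor and applying \<open>d/dz\<close> at \<open>z = 1\<close> counts the occurrences of the part \<open>k\<close>; its effect is to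
  multiply the product by \<open>X\<^sup>k / (1 \<plusminus> X\<^sup>k)\<close>. Hence the total weight of all parts has the
  generating function
  \<open>(\<Prod>k. factor k) * (\<Sum>k. w k * X\<^sup>k / (1 \<plusminus> X\<^sup>k))\<close>, which is \<open>partition_gf_weight\<close>, stated for
  parts bounded by \<open>N\<close> so that every product and sum is finite. In the proof,
  splitting off the largest part takes the place of \<open>z\<close>: it yields recurrences in \<open>N\<close> for the
  counting and for the weighted series, and both are solved by induction.

  Let now \<open>D\<close> be the set of positive even numbers and \<open>w k = k\<close> for odd \<open>k\<close>, \<open>w k = - k\<close> for even
  \<open>k\<close>. As \<open>N\<close> grows, the product tends to the quotient of the two q-Pochhammer symbols
  (\<open>partition_gf_even_distinct\<close>). In terms of \<open>x = - X\<close>, the \<open>k\<close>-th summand is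
  \<open>- k x\<^sup>k / (1 + x\<^sup>k)\<close> for either parity of \<open>k\<close>, because the sign of the weight and the sign in
  the denominator change together. Expanding geometric series and exchanging the order of
  summation,
  \<open>\<Sum>k. - k x\<^sup>k / (1 + x\<^sup>k) = \<Sum>k. \<Sum>m. (-1)\<^sup>m k x\<^sup>k\<^sup>m = \<Sum>m. (-1)\<^sup>m x\<^sup>m / (1 - x\<^sup>m)\<^sup>2\<close>,
  and \<open>(-1)\<^sup>m x\<^sup>m = X\<^sup>m\<close>; this is \<open>lambert_tendsto\<close>.
\<close>

section \<open>Partitions with bounded parts\<close>

definition bounded_partitions :: "nat set \<Rightarrow> nat \<Rightarrow> nat \<Rightarrow> nat list set" where
  "bounded_partitions D N n = {xs \<in> partitions_distinct_on D n. set xs \<subseteq> {..N}}"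

definition partition_gf :: "nat set \<Rightarrow> nat \<Rightarrow> (nat list \<Rightarrow> 'a::comm_ring_1) \<Rightarrow> 'a fps" where
  "partition_gf D N F = Abs_fps (\<lambda>n. \<Sum>xs\<in>bounded_partitions D N n. F xs)"

lemma finite_bounded_partitions: "finite (bounded_partitions D N n)"
  unfolding bounded_partitions_def
  by (rule finite_subset[OF _ finite_partitions_distinct_on]) auto

text \<open>
  A partition with parts at most \<open>Suc N\<close> either avoids \<open>Suc N\<close>, or has it as its head. In the
  latter case the tail may contain \<open>Suc N\<close> again exactly when this part is allowed to repeat,
  which accounts for the two bounds on the tail.
\<close>

lemma bounded_partitions_Suc:
  "bounded_partitions D (Suc N) n = bounded_partitions D N n \<union>
     (if Suc N \<le> n then Cons (Suc N) ` bounded_partitions D (if Suc N \<in> D then N else Suc N) (n - Suc N)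
      else {})" (is "?L = ?A \<union> ?B")
proof (intro equalityI subsetI)
  fix xs assume xs: "xs \<in> ?L"
  show "xs \<in> ?A \<union> ?B"
  proof (cases "Suc N \<in> set xs")
    case False
    hence "set xs \<subseteq> {..N}"
      using xs by (force simp: bounded_partitions_def le_Suc_eq)
    thus ?thesis
      using xs by (simp add: bounded_partitions_def)
  next
    case True
    then obtain y ys where y: "xs = y # ys"
      by (cases xs) auto
    hence yN: "y = Suc N"
      using xs True
      by (auto simp: bounded_partitions_def partitions_distinct_on_def partitions_def intro: antisym)
    have cnt: "count_list ys d \<le> 1" if "d \<in> D" for d
      using xs that y
      by (force simp: bounded_partitions_def partitions_distinct_on_def split: if_splits)
    have "Suc N \<notin> set ys" if "Suc N \<in> D"
      using xs that y yN
      by (auto simp: bounded_partitions_def partitions_distinct_on_def count_list_0_iff)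
    moreover have "set ys \<subseteq> {..Suc N}"
      using xs y by (auto simp: bounded_partitions_def)
    ultimately have "set ys \<subseteq> {..if Suc N \<in> D then N else Suc N}"
      by (auto simp: subset_iff le_Suc_eq)
    hence "ys \<in> bounded_partitions D (if Suc N \<in> D then N else Suc N) (n - Suc N)"
      using xs y yN cnt
      by (auto simp: bounded_partitions_def partitions_distinct_on_def partitions_def)
    moreover have "Suc N \<le> n"
      using xs y yN by (auto simp: bounded_partitions_def partitions_distinct_on_def partitions_def)
    ultimately show ?thesis
      using y yN by auto
  qed
next
  fix xs assume "xs \<in> ?A \<union> ?B"
  thus "xs \<in> ?L"
  proof
    assume "xs \<in> ?A"
    thus ?thesis by (auto simp: bounded_partitions_def)
  next
    assume "xs \<in> ?B"
    then obtain ys where n: "Suc N \<le> n" and xs: "xs = Suc N # ys"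
      and ys: "ys \<in> bounded_partitions D (if Suc N \<in> D then N else Suc N) (n - Suc N)"
      by (auto split: if_splits)
    have "Suc N \<notin> set ys" if "Suc N \<in> D"
      using ys that by (auto simp: bounded_partitions_def)
    hence "count_list ys (Suc N) = 0" if "Suc N \<in> D"
      using that by (simp add: count_list_0_iff)
    moreover have "set ys \<subseteq> {..Suc N}"
      using ys by (auto simp: bounded_partitions_def split: if_splits)
    ultimately show ?thesis
      using ys n xs
      by (auto simp: bounded_partitions_def partitions_distinct_on_def partitions_def)
  qed
qed

lemma partition_gf_Suc:
  "partition_gf D (Suc N) F = partition_gf D N F +
     fps_X ^ Suc N * partition_gf D (if Suc N \<in> D then N else Suc N) (\<lambda>xs. F (Suc N # xs))"
proof (rule fps_ext)
  fix n
  let ?M = "if Suc N \<in> D then N else Suc N"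
  let ?B = "if Suc N \<le> n then Cons (Suc N) ` bounded_partitions D ?M (n - Suc N) else {}"
  have "partition_gf D (Suc N) F $ n = (\<Sum>xs\<in>bounded_partitions D N n \<union> ?B. F xs)"
    by (simp only: partition_gf_def fps_nth_Abs_fps bounded_partitions_Suc)
  also have "\<dots> = (\<Sum>xs\<in>bounded_partitions D N n. F xs) + (\<Sum>xs\<in>?B. F xs)"
    by (rule sum.union_disjoint)
       (auto simp: finite_bounded_partitions, auto simp: bounded_partitions_def)
  also have "(\<Sum>xs\<in>?B. F xs) =
      (if Suc N \<le> n then \<Sum>xs\<in>bounded_partitions D ?M (n - Suc N). F (Suc N # xs) else 0)"
    by (simp add: sum.reindex)
  finally show "partition_gf D (Suc N) F $ n = (partition_gf D N F +
     fps_X ^ Suc N * partition_gf D ?M (\<lambda>xs. F (Suc N # xs))) $ n"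
    by (auto simp: partition_gf_def fps_X_power_mult_nth simp del: power_Suc)
qed

lemma partition_gf_0: "partition_gf D 0 F = fps_const (F [])"
proof (rule fps_ext)
  fix n
  have "bounded_partitions D 0 n = (if n = 0 then {[]} else {})"
  proof -
    have "xs = []" if "xs \<in> bounded_partitions D 0 n" for xs
      using that by (cases xs) (auto simp: bounded_partitions_def partitions_distinct_on_def partitions_def)
    moreover have "[] \<in> bounded_partitions D 0 n \<longleftrightarrow> n = 0"
      by (auto simp: bounded_partitions_def partitions_distinct_on_def partitions_def)
    ultimately show ?thesis
      by (cases "n = 0") (simp_all, blast+)
  qed
  thus "partition_gf D 0 F $ n = fps_const (F []) $ n"
    by (simp add: partition_gf_def)
qed

lemma partition_gf_add_const:
  "partition_gf D N (\<lambda>xs. c + F xs) = fps_const c * partition_gf D N (\<lambda>_. 1) + partition_gf D N F"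
  by (rule fps_ext) (simp add: partition_gf_def sum.distrib mult.commute)

section \<open>Product formula for the weighted count\<close>

definition part_factor :: "nat set \<Rightarrow> nat \<Rightarrow> 'a::field fps" where
  "part_factor D k = (if k \<in> D then 1 + fps_X ^ k else inverse (1 - fps_X ^ k))"

text \<open>
  The logarithmic derivative in \<open>z\<close>, at \<open>z = 1\<close>, of the factor \<open>1 + z X\<^sup>k\<close> or \<open>1 / (1 - z X\<^sup>k)\<close>
  in which \<open>z\<close> marks each occurrence of the part \<open>k\<close>.
\<close>

definition part_log_derivative :: "nat set \<Rightarrow> nat \<Rightarrow> 'a::field fps" where
  "part_log_derivative D k = fps_X ^ k / (if k \<in> D then 1 + fps_X ^ k else 1 - fps_X ^ k)"

lemma partition_gf_one:
  "partition_gf D N (\<lambda>_. 1) = (\<Prod>k=1..N. part_factor D k :: 'a::field fps)"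
proof (induction N)
  case 0
  thus ?case by (simp add: partition_gf_0)
next
  case (Suc N)
  let ?G = "\<lambda>N. partition_gf D N (\<lambda>_. 1) :: 'a fps"
  have "?G (Suc N) = ?G N * part_factor D (Suc N)"
  proof (cases "Suc N \<in> D")
    case True
    thus ?thesis
      by (subst partition_gf_Suc) (simp add: part_factor_def algebra_simps)
  next
    case False
    have unit: "(1 - fps_X ^ Suc N :: 'a fps) * inverse (1 - fps_X ^ Suc N) = 1"
      by (rule inverse_mult_eq_1') simp
    have "?G (Suc N) * (1 - fps_X ^ Suc N) = ?G N"
      using False partition_gf_Suc[of D N "\<lambda>_. 1 :: 'a"] by (simp add: algebra_simps)
    hence "?G N * inverse (1 - fps_X ^ Suc N) =
        ?G (Suc N) * ((1 - fps_X ^ Suc N) * inverse (1 - fps_X ^ Suc N))"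
      by (simp add: mult.assoc)
    thus ?thesis
      unfolding unit using False by (simp add: part_factor_def)
  qed
  with Suc.IH show ?case by simp
qed

text \<open>
  Write \<open>G, W\<close> for the counting and the weighted series with bound \<open>N\<close>, and \<open>G', W'\<close> for those
  with bound \<open>Suc N\<close>; let \<open>x = X^(Suc N)\<close> and let \<open>c\<close> be the weight of \<open>Suc N\<close>. Splitting off the
  part \<open>Suc N\<close> gives \<open>W' = W + x (c G + W)\<close> if it must not repeat and \<open>W' = W + x (c G' + W')\<close> if
  it may. In both cases, the corresponding relation between \<open>G\<close> and \<open>G'\<close> turns this into
  \<open>W' / G' = W / G + c * part_log_derivative D (Suc N)\<close>.
\<close>

lemma partition_gf_weight:
  fixes w :: "nat \<Rightarrow> 'a::field"
  shows "partition_gf D N (\<lambda>xs. sum_list (map w xs)) =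
     partition_gf D N (\<lambda>_. 1) * (\<Sum>k=1..N. fps_const (w k) * part_log_derivative D k)"
proof (induction N)
  case 0
  thus ?case by (simp add: partition_gf_0)
next
  case (Suc N)
  define x G G' W W' C c where "x = (fps_X ^ Suc N :: 'a fps)"
    and "G = (partition_gf D N (\<lambda>_. 1) :: 'a fps)"
    and "G' = (partition_gf D (Suc N) (\<lambda>_. 1) :: 'a fps)"
    and "W = partition_gf D N (\<lambda>xs. sum_list (map w xs))"
    and "W' = partition_gf D (Suc N) (\<lambda>xs. sum_list (map w xs))"
    and "C = (\<Sum>k=1..N. fps_const (w k) * part_log_derivative D k)"
    and "c = fps_const (w (Suc N))"
  note defs = x_def G_def G'_def W_def W'_def C_def c_def
  have x0: "x $ 0 = 0" by (simp add: x_def)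
  have W: "W = G * C" using Suc.IH by (simp add: defs)
  have "W' = G' * (C + c * part_log_derivative D (Suc N))"
  proof (cases "Suc N \<in> D")
    case True
    have G': "G' = G * (1 + x)"
      using True partition_gf_Suc[of D N "\<lambda>_. 1 :: 'a"] by (simp add: defs algebra_simps)
    have W': "W' = W + x * (c * G + W)"
      using True partition_gf_Suc[of D N "\<lambda>xs. sum_list (map w xs)"]
      by (simp add: defs partition_gf_add_const)
    have "(1 + x) * part_log_derivative D (Suc N) = x"
      using True x0 by (simp add: part_log_derivative_def flip: x_def power_Suc)
    moreover have "G' * (C + c * part_log_derivative D (Suc N)) =
        G * (1 + x) * C + c * G * ((1 + x) * part_log_derivative D (Suc N))"
      by (simp add: G' algebra_simps)
    ultimately show ?thesis by (simp add: W' W algebra_simps)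
  next
    case False
    have G': "G' * (1 - x) = G"
      using False partition_gf_Suc[of D N "\<lambda>_. 1 :: 'a"] by (simp add: defs algebra_simps)
    have W': "W' = W + x * (c * G' + W')"
      using False partition_gf_Suc[of D N "\<lambda>xs. sum_list (map w xs)"]
      by (simp add: defs partition_gf_add_const)
    have L: "(1 - x) * part_log_derivative D (Suc N) = x"
      using False x0 by (simp add: part_log_derivative_def flip: x_def power_Suc)
    have "(1 - x) * (G' * (C + c * part_log_derivative D (Suc N))) =
        G' * (1 - x) * C + c * G' * ((1 - x) * part_log_derivative D (Suc N))"
      by (simp add: algebra_simps)
    also have "\<dots> = W + c * G' * x" by (simp only: G' L W)
    also have "\<dots> = (1 - x) * W'" using W' by (simp add: algebra_simps)
    finally have "(1 - x) * W' = (1 - x) * (G' * (C + c * part_log_derivative D (Suc N)))" ..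
    moreover have "1 - x \<noteq> 0" using x0 by (metis fps_sub_nth fps_zero_nth fps_one_nth diff_zero zero_neq_one)
    ultimately show ?thesis by simp
  qed
  thus ?case by (simp add: defs)
qed

section \<open>Coefficients of geometric series, limits\<close>

text \<open>
  The difference of the series and its truncation after \<open>y\<^sup>N\<close> is a multiple of \<open>y\<close> to the power
  \<open>Suc N\<close>, which has no coefficient of degree at most \<open>N\<close>; the same holds for
  \<open>y / (1 - y)\<^sup>2\<close> below.
\<close>

lemma geometric_nth:
  fixes y :: "'a::field fps"
  assumes "y $ 0 = 0" "j \<le> N"
  shows "(y / (1 - y)) $ j = (\<Sum>m=1..N. (y ^ m) $ j)"
proof -
  have inv: "(1 - y) * inverse (1 - y) = 1"
    using assms by (intro inverse_mult_eq_1') simp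
  have "(1 - y) * (\<Sum>m=1..N. y ^ m) = y - y ^ Suc N" for N
  proof (induction N)
    case (Suc N)
    have "(1 - y) * (\<Sum>m=1..Suc N. y ^ m) = (1 - y) * (\<Sum>m=1..N. y ^ m) + (1 - y) * y ^ Suc N"
      by (simp add: distrib_left)
    also have "\<dots> = y - y ^ Suc (Suc N)"
      unfolding Suc by (simp add: algebra_simps)
    finally show ?case .
  qed simp
  hence "y = (1 - y) * (\<Sum>m=1..N. y ^ m) + y ^ Suc N" by simp
  hence "y * inverse (1 - y) =
      (1 - y) * inverse (1 - y) * (\<Sum>m=1..N. y ^ m) + inverse (1 - y) * y ^ Suc N"
    by (metis (no_types, lifting) distrib_left mult.commute mult.left_commute)
  hence "y / (1 - y) = (\<Sum>m=1..N. y ^ m) + inverse (1 - y) * y ^ Suc N"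
    using assms by (simp add: fps_divide_unit inv del: power_Suc)
  moreover have "(inverse (1 - y) * y ^ Suc N) $ j = 0"
    using assms by (intro nth_mult_power_eq_0) auto
  ultimately show ?thesis by (simp add: fps_sum_nth del: power_Suc)
qed

lemma geometric_derivative_nth:
  fixes y :: "'a::field fps"
  assumes "y $ 0 = 0" "j \<le> N"
  shows "(y / (1 - y) ^ 2) $ j = (\<Sum>m=1..N. of_nat m * (y ^ m) $ j)"
proof -
  let ?I = "inverse ((1 - y) ^ 2)"
  have inv: "(1 - y) ^ 2 * ?I = 1"
    using assms by (intro inverse_mult_eq_1') simp
  have "(1 - y) ^ 2 * (\<Sum>m=1..N. of_nat m * y ^ m) =
      y - (of_nat (Suc N) - of_nat N * y) * y ^ Suc N" for N
  proof (induction N)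
    case (Suc N)
    have "(1 - y) ^ 2 * (\<Sum>m=1..Suc N. of_nat m * y ^ m) =
        (1 - y) ^ 2 * (\<Sum>m=1..N. of_nat m * y ^ m) + (1 - y) ^ 2 * (of_nat (Suc N) * y ^ Suc N)"
      by (simp add: distrib_left)
    also have "\<dots> = y - (of_nat (Suc (Suc N)) - of_nat (Suc N) * y) * y ^ Suc (Suc N)"
      unfolding Suc by (simp add: algebra_simps power2_eq_square)
    finally show ?case .
  qed simp
  hence "y = (1 - y) ^ 2 * (\<Sum>m=1..N. of_nat m * y ^ m) + (of_nat (Suc N) - of_nat N * y) * y ^ Suc N"
    by simp
  hence "y * ?I = ((1 - y) ^ 2 * (\<Sum>m=1..N. of_nat m * y ^ m) + (of_nat (Suc N) - of_nat N * y) * y ^ Suc N) * ?I"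
    by (rule arg_cong)
  also have "\<dots> = (1 - y) ^ 2 * ?I * (\<Sum>m=1..N. of_nat m * y ^ m) +
      (?I * (of_nat (Suc N) - of_nat N * y)) * y ^ Suc N"
    by (simp only: algebra_simps)
  finally have "y / (1 - y) ^ 2 = (\<Sum>m=1..N. of_nat m * y ^ m) +
      (?I * (of_nat (Suc N) - of_nat N * y)) * y ^ Suc N"
    using assms by (simp add: fps_divide_unit inv del: power_Suc)
  moreover have "((?I * (of_nat (Suc N) - of_nat N * y)) * y ^ Suc N) $ j = 0"
    using assms by (intro nth_mult_power_eq_0) auto
  ultimately show ?thesis
    by (simp add: fps_sum_nth fps_mult_of_nat_nth del: power_Suc)
qed


lemma tendsto_mult_fps:
  fixes f g :: "'b \<Rightarrow> 'a::comm_ring_1 fps"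
  assumes "(f \<longlongrightarrow> a) F" "(g \<longlongrightarrow> b) F"
  shows "((\<lambda>x. f x * g x) \<longlongrightarrow> a * b) F"
proof (rule tendsto_fpsI)
  fix n
  have "\<forall>\<^sub>F x in F. \<forall>i\<in>{..n}. f x $ i = a $ i \<and> g x $ i = b $ i"
    using assms by (intro eventually_ball_finite ballI eventually_conj) (auto simp: tendsto_fps_iff)
  thus "\<forall>\<^sub>F x in F. (f x * g x) $ n = (a * b) $ n"
    by eventually_elim (auto simp: fps_mult_nth intro!: sum.cong)
qed

lemma suminf_fps_nth:
  fixes f :: "nat \<Rightarrow> 'a::comm_ring_1 fps"
  assumes "\<And>n i. i \<le> n \<Longrightarrow> f n $ i = 0" "j \<le> N"
  shows "suminf f $ j = (\<Sum>n<N. f n $ j)"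
proof -
  have stable: "(\<Sum>n<N. f n $ j) = (\<Sum>n<j. f n $ j)" if "j \<le> N" for j N
    using that assms(1) by (intro sum.mono_neutral_right) auto
  have "f sums Abs_fps (\<lambda>j. \<Sum>n<j. f n $ j)"
    unfolding sums_def
    by (rule tendsto_fpsI, rule eventually_sequentiallyI) (simp add: fps_sum_nth, rule stable)
  hence "suminf f = Abs_fps (\<lambda>j. \<Sum>n<j. f n $ j)"
    by (simp add: sums_iff)
  thus ?thesis
    using stable[OF assms(2), symmetric] by simp
qed

section \<open>Distinct even parts\<close>

text \<open>
  The bound \<open>2 * M\<close> makes the factors pair up: going from \<open>M\<close> to \<open>Suc M\<close> adds one odd and one
  even part, that is, one factor of each of the two q-Pochhammer symbols.
\<close>

lemma partition_gf_even_distinct: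
  "(\<lambda>M. partition_gf {k. 0 < k \<and> even k} (2 * M) (\<lambda>_. 1) :: rat fps)
     \<longlonglongrightarrow> qpochhammer_inf (- (fps_X ^ 2)) (fps_X ^ 2) / qpochhammer_inf fps_X (fps_X ^ 2)"
proof -
  let ?X = "fps_X :: rat fps" and ?D = "{k::nat. 0 < k \<and> even k}"
  let ?A = "\<lambda>M. \<Prod>m<M. 1 - (- (?X ^ 2)) * (?X ^ 2) ^ m"
  let ?B = "\<lambda>M. \<Prod>m<M. 1 - ?X * (?X ^ 2) ^ m"
  have A: "?A \<longlonglongrightarrow> qpochhammer_inf (- (?X ^ 2)) (?X ^ 2)"
    by (intro has_prod_imp_tendsto' has_prod_qpochhammer_inf) simp_all
  have B: "?B \<longlonglongrightarrow> qpochhammer_inf ?X (?X ^ 2)"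
    by (intro has_prod_imp_tendsto' has_prod_qpochhammer_inf) simp_all
  \<comment> \<open>Inversion is continuous only at series with nonzero constant coefficient.\<close>
  have "?B M $ 0 = 1" for M
    by (induction M) auto
  moreover from B have "\<forall>\<^sub>F M in sequentially. ?B M $ 0 = qpochhammer_inf ?X (?X ^ 2) $ 0"
    by (simp only: tendsto_fps_iff)
  ultimately have B0: "qpochhammer_inf ?X (?X ^ 2) $ 0 = 1"
    by simp
  have "partition_gf ?D (2 * M) (\<lambda>_. 1) = ?A M * inverse (?B M)" for M
  proof (induction M)
    case 0
    show ?case by (simp add: partition_gf_one)
  next
    case (Suc M)
    have "(\<Prod>k=1..2 * Suc M. part_factor ?D k) =
        (\<Prod>k=1..2 * M. part_factor ?D k) * part_factor ?D (Suc (2 * M)) * part_factor ?D (Suc (Suc (2 * M)))"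
      by simp
    moreover have "part_factor ?D (Suc (2 * M)) = inverse (1 - ?X * (?X ^ 2) ^ M)"
      by (simp add: part_factor_def flip: power_mult)
    moreover have "part_factor ?D (Suc (Suc (2 * M))) = 1 - (- (?X ^ 2)) * (?X ^ 2) ^ M"
      by (simp add: part_factor_def power_mult power2_eq_square mult.assoc)
    ultimately show ?case
      using Suc by (simp add: partition_gf_one fps_inverse_mult mult_ac)
  qed
  moreover have "(\<lambda>M. ?A M * inverse (?B M)) \<longlonglongrightarrow>
      qpochhammer_inf (- (?X ^ 2)) (?X ^ 2) * inverse (qpochhammer_inf ?X (?X ^ 2))"
    using B0 by (intro tendsto_mult_fps A tendsto_inverse_fps B) simp
  ultimately show ?thesis
    using B0 by (simp add: fps_divide_unit)
qed

definition signed_part :: "nat \<Rightarrow> 'a::ring_1" where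
  "signed_part k = (if even k then - of_nat k else of_nat k)"

lemma sum_list_signed_part:
  "sum_list (map signed_part xs) =
     (of_int (int (sum_list (filter odd xs)) - int (sum_list (filter even xs))) :: 'a::ring_1)"
  by (induction xs) (auto simp: signed_part_def)

lemma partition_gf_signed_nth:
  assumes "n \<le> N"
  shows "partition_gf D N (\<lambda>xs. sum_list (map signed_part xs)) $ n = (of_int (S D n) :: 'a::comm_ring_1)"
proof -
  have "set xs \<subseteq> {..N}" if "xs \<in> partitions_distinct_on D n" for xs
    using that assms member_le_sum_list[of _ xs]
    by (fastforce simp: partitions_distinct_on_def partitions_def)
  hence "bounded_partitions D N n = partitions_distinct_on D n"
    by (auto simp: bounded_partitions_def)
  thus ?thesis
    by (simp add: partition_gf_def S_def sum_list_signed_part)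
qed

text \<open>
  The series starts at \<open>n = 1\<close>, but the generating function of bounded partitions also counts the
  empty partition of \<open>0\<close>; that partition has no parts, so it contributes \<open>0\<close>.
\<close>

lemma partition_gf_signed_tendsto:
  "(\<lambda>N. partition_gf D N (\<lambda>xs. sum_list (map signed_part xs)))
     \<longlonglongrightarrow> (\<Sum>n. of_int (S D (Suc n)) * fps_X ^ Suc n :: 'a::comm_ring_1 fps)"
proof (rule tendsto_fpsI, rule eventually_sequentiallyI)
  fix j N :: nat assume "j \<le> N"
  have nth: "(of_int c * fps_X ^ m :: 'a fps) $ i = (if i = m then of_int c else 0)" for c m i
    by (simp add: fps_of_int [symmetric] fps_X_power_nth)
  have "(\<Sum>n. of_int (S D (Suc n)) * fps_X ^ Suc n :: 'a fps) $ j =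
      (\<Sum>n<j. (of_int (S D (Suc n)) * fps_X ^ Suc n :: 'a fps) $ j)"
    by (rule suminf_fps_nth) (simp_all add: nth del: power_Suc)
  also have "\<dots> = of_int (S D j)"
  proof (cases j)
    case 0
    have "partitions_distinct_on D 0 = {[]}"
    proof -
      have "xs = []" if "xs \<in> partitions_distinct_on D 0" for xs
        using that by (cases xs) (auto simp: partitions_distinct_on_def partitions_def)
      moreover have "[] \<in> partitions_distinct_on D 0"
        by (auto simp: partitions_distinct_on_def partitions_def)
      ultimately show ?thesis by blast
    qed
    thus ?thesis using 0 by (simp add: S_def)
  next
    case (Suc i)
    thus ?thesis by (simp add: nth del: power_Suc)
  qed
  finally show "partition_gf D N (\<lambda>xs. sum_list (map signed_part xs)) $ j =
      (\<Sum>n. of_int (S D (Suc n)) * fps_X ^ Suc n :: 'a fps) $ j"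
    using \<open>j \<le> N\<close> by (simp add: partition_gf_signed_nth)
qed

section \<open>Exchanging the order of summation\<close>

lemma minus_one_power_mult_nth:
  fixes f :: "'a::comm_ring_1 fps"
  shows "((- 1) ^ m * f) $ j = (- 1) ^ m * (f $ j)"
  by (induction m) (simp_all add: mult.assoc)

text \<open>
  For either parity of \<open>k\<close> the left-hand series equals \<open>k y / (1 - y)\<close> with \<open>y = - ((- X)\<^sup>k)\<close>: for
  odd \<open>k\<close> one has \<open>y = X\<^sup>k\<close>, and for even \<open>k\<close> one has \<open>y = - (X\<^sup>k)\<close>. Its geometric expansion
  and that of \<open>lambert_square_term_nth\<close> are written with the same summand, a function of \<open>k\<close> and
  \<open>m\<close>, so that they are the two ways to sum over a square of pairs.
\<close>

lemma signed_lambert_term_nth: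
  assumes "1 \<le> k" "j \<le> N"
  shows "(fps_const (signed_part k) * part_log_derivative {k. 0 < k \<and> even k} k :: 'a::field fps) $ j =
     (\<Sum>m=1..N. of_nat k * (- 1) ^ m * ((- fps_X) ^ (k * m) $ j))"
proof -
  define y where "y = - ((- fps_X :: 'a fps) ^ k)"
  have y0: "y $ 0 = 0" using assms by (simp add: y_def)
  have "fps_const (signed_part k) * part_log_derivative {k. 0 < k \<and> even k} k =
      of_nat k * (y / (1 - y))"
  proof (cases "even k")
    case True
    hence "y = - (fps_X ^ k)" by (simp add: y_def)
    thus ?thesis using True assms
      by (simp add: signed_part_def part_log_derivative_def fps_of_nat [symmetric] fps_divide_unit
               flip: fps_const_neg)
  next
    case False
    hence "y = fps_X ^ k" by (simp add: y_def)
    thus ?thesis using False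
      by (simp add: signed_part_def part_log_derivative_def fps_of_nat [symmetric])
  qed
  hence "(fps_const (signed_part k) * part_log_derivative {k. 0 < k \<and> even k} k) $ j =
      of_nat k * (\<Sum>m=1..N. (y ^ m) $ j)"
    using geometric_nth[OF y0 assms(2)] by (simp add: fps_mult_of_nat_nth)
  moreover have "y ^ m $ j = (- 1) ^ m * ((- fps_X) ^ (k * m) $ j)" for m
  proof -
    have "y ^ m = (- 1) ^ m * (- fps_X) ^ (k * m)"
      by (simp add: y_def power_mult power_minus [of "_ ^ _"])
    thus ?thesis by (simp add: minus_one_power_mult_nth)
  qed
  ultimately show ?thesis
    by (simp add: sum_distrib_left mult.assoc)
qed

lemma lambert_square_term_nth:
  assumes "1 \<le> m" "j \<le> N"
  shows "(fps_X ^ m / (1 - (- fps_X) ^ m) ^ 2 :: 'a::field fps) $ j =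
     (\<Sum>k=1..N. of_nat k * (- 1) ^ m * ((- fps_X) ^ (k * m) $ j))"
proof -
  let ?y = "(- fps_X :: 'a fps) ^ m"
  have y0: "?y $ 0 = 0" using assms by simp
  have unit: "((1 - ?y) ^ 2) $ 0 \<noteq> 0" by (simp add: y0)
  have "fps_X ^ m = (- 1 :: 'a fps) ^ m * ?y"
    by (simp flip: power_mult_distrib)
  hence "fps_X ^ m / (1 - ?y) ^ 2 = (- 1) ^ m * (?y / (1 - ?y) ^ 2)"
    by (simp only: fps_divide_unit [OF unit] mult.assoc)
  hence "(fps_X ^ m / (1 - ?y) ^ 2) $ j = (- 1) ^ m * (\<Sum>k=1..N. of_nat k * (?y ^ k $ j))"
    using geometric_derivative_nth[OF y0 assms(2)] by (simp add: minus_one_power_mult_nth)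
  thus ?thesis
    by (simp add: sum_distrib_left mult_ac flip: power_mult)
qed

lemma lambert_tendsto:
  "(\<lambda>N. \<Sum>k=1..N. fps_const (signed_part k) * part_log_derivative {k. 0 < k \<and> even k} k)
     \<longlonglongrightarrow> (\<Sum>n. fps_X ^ Suc n / (1 - (- fps_X) ^ Suc n) ^ 2 :: 'a::field fps)"
proof (rule tendsto_fpsI, rule eventually_sequentiallyI)
  fix j N :: nat assume N: "j \<le> N"
  let ?r = "\<lambda>m. fps_X ^ m / (1 - (- fps_X) ^ m) ^ 2 :: 'a fps"
  have "?r (Suc n) $ i = 0" if "i \<le> n" for n i
  proof -
    have "?r (Suc n) = inverse ((1 - (- fps_X) ^ Suc n) ^ 2) * fps_X ^ Suc n"
      by (simp add: fps_divide_unit mult.commute)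
    thus ?thesis
      using that nth_mult_power_eq_0[of fps_X i "Suc n"] by simp
  qed
  hence "(\<Sum>n. ?r (Suc n)) $ j = (\<Sum>n<N. ?r (Suc n) $ j)"
    using N by (rule suminf_fps_nth)
  also have "\<dots> = (\<Sum>m=1..N. ?r m $ j)"
    by (rule sum.reindex_bij_witness[of _ "\<lambda>m. m - 1" Suc]) auto
  also have "\<dots> = (\<Sum>m=1..N. \<Sum>k=1..N. of_nat k * (- 1) ^ m * ((- fps_X) ^ (k * m) $ j))"
    using N by (intro sum.cong lambert_square_term_nth) auto
  also have "\<dots> = (\<Sum>k=1..N. \<Sum>m=1..N. of_nat k * (- 1) ^ m * ((- fps_X) ^ (k * m) $ j))"
    by (rule sum.swap)
  also have "\<dots> = (\<Sum>k=1..N. (fps_const (signed_part k) * part_log_derivative {k. 0 < k \<and> even k} k) $ j)"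
    using N by (intro sum.cong signed_lambert_term_nth [symmetric]) auto
  finally show "(\<Sum>k=1..N. fps_const (signed_part k) * part_log_derivative {k. 0 < k \<and> even k} k) $ j =
      (\<Sum>n. ?r (Suc n)) $ j"
    by (simp add: fps_sum_nth)
qed

theorem theorem4p1:
  defines "q \<equiv> (fps_X :: rat fps)"
  shows "(\<Sum>n. of_int (S {k. 0 < k \<and> even k} (Suc n)) * q ^ Suc n) =
    qpochhammer_inf (- (q ^ 2)) (q ^ 2) / qpochhammer_inf q (q ^ 2) *
    (\<Sum>n. q ^ Suc n / (1 - (- q) ^ Suc n) ^ 2)"
proof -
  let ?D = "{k::nat. 0 < k \<and> even k}"
  have double: "filterlim (\<lambda>M. 2 * M :: nat) sequentially sequentially"
    by (rule filterlim_subseq) (simp add: strict_mono_def)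
  let ?W = "\<lambda>M. partition_gf ?D (2 * M) (\<lambda>xs. sum_list (map signed_part xs)) :: rat fps"
  have "?W \<longlonglongrightarrow> (\<Sum>n. of_int (S ?D (Suc n)) * q ^ Suc n)"
    unfolding q_def by (rule filterlim_compose[OF partition_gf_signed_tendsto double])
  moreover have "?W \<longlonglongrightarrow> qpochhammer_inf (- (q ^ 2)) (q ^ 2) / qpochhammer_inf q (q ^ 2) *
      (\<Sum>n. q ^ Suc n / (1 - (- q) ^ Suc n) ^ 2)"
    unfolding partition_gf_weight q_def
    by (intro tendsto_mult_fps partition_gf_even_distinct filterlim_compose[OF lambert_tendsto double])
  ultimately show ?thesis
    by (rule LIMSEQ_unique)
qed

end
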